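(* Let $Z^{\mathrm{CF}}$ be the optimal value of $\min_{\mathbf c\in\mathbb Z^{|\mathcal E|}}\sum_{e\in\mathcal E}\Psi_e(c_e;S_e)$ subject to $\mathbf I\mathbf c=\mathbf I^+\mathbf s$, and let $Z^{\mathrm{RLX}}$ be the optimal value of its continuous relaxation $\min_{\mathbf c\in\mathbb R^{|\mathcal E|}}\sum_{e\in\mathcal E}\Psi_e(c_e;S_e)$ subject to $\mathbf I\mathbf c=\mathbf I^+\mathbf s$. Then $Z^{\mathrm{CF}}=Z^{\mathrm{RLX}}$.
   Context: $(\mathcal V,\mathcal E)$ is an undirected network. Each edge $e\in\mathcal E$ has length $l_e\ge 0$ and end nodes $v_e^-,v_e^+\in\mathcal V$ (an arbitrary orientation from $v_e^-$ to $v_e^+$ is fixed). A location on $e$ is recorded as $(e,x)$, $x\in[0,l_e]$, where $x$ is the distance from $v_e^-$ along $e$. Put $\mathcal L_e(x)=\{(e,y):y\in[0,x]\}$ and $\mathcal L=\bigcup_{e}\mathcal L_e(l_e)$. $U,V\subset\mathcal L$ are finite sets of supply and demand points with $|U|=|V|=n$. The imbalance profile of edge $e$ is $S_e(x)=|U\cap\mathcal L_e(x)|-|V\cap\mathcal L_e(x)|$ for $x\in[0,l_e]$, and $\mathbf s=(S_e(l_e))_{e\in\mathcal E}$. For a profile $\xi_e:[0,l_e]\to\mathbb R$ and $c\in\mathbb R$, $\Psi_e(c;\xi_e)=\int_0^{l_e}|\xi_e(x)-c|\,dx$. $\mathbf I^+$ (resp. $\mathbf I^-$) is the $\mathcal V\times\mathcal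 E$ matrix whose $(v,e)$ entry is $1$ if $v_e^+=v$ (resp. $v_e^-=v$) and $0$ otherwise; $\mathbf I=\mathbf I^+-\mathbf I^-$. *)

theory Defs
  imports "HOL-Analysis.Analysis"
begin

text \<open>
  The node set and the edge set of the network are the finite types \<open>'v\<close> and \<open>'e\<close>. Edge
  \<open>e\<close> has length \<open>len e\<close> and runs from \<open>vm e\<close> (the node \<open>v\<^sub>e\<^sup>-\<close>) to \<open>vp e\<close> (the node \<open>v\<^sub>e\<^sup>+\<close>);
  loops and parallel edges are allowed. A location is a pair of an edge and the distance from
  \<open>vm e\<close>, so the point sitting at a node has one location for each edge end at that node.
\<close>

type_synonym 'e location = "'e \<times> real"

definition edge_locations :: "'e \<Rightarrow> real \<Rightarrow> 'e location set" where
  "edge_locations e x = {(e, y) | y. y \<in> {0..x}}"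

definition locations :: "('e \<Rightarrow> real) \<Rightarrow> 'e location set" where
  "locations len = (\<Union>e. edge_locations e (len e))"

definition imbalance :: "'e location set \<Rightarrow> 'e location set \<Rightarrow> 'e \<Rightarrow> real \<Rightarrow> real" where
  "imbalance U V e x = real (card (U \<inter> edge_locations e x)) - real (card (V \<inter> edge_locations e x))"

definition total_imbalance ::
    "('e::finite \<Rightarrow> real) \<Rightarrow> 'e location set \<Rightarrow> 'e location set \<Rightarrow> real ^ 'e" where
  "total_imbalance len U V = (\<chi> e. imbalance U V e (len e))"

definition profile_cost :: "('e \<Rightarrow> real) \<Rightarrow> 'e \<Rightarrow> real \<Rightarrow> (real \<Rightarrow> real) \<Rightarrow> real" where
  "profile_cost len e c \<xi> = integral {0..len e} (\<lambda>x. \<bar>\<xi> x - c\<bar>)"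

text \<open>The same function serves for \<open>\<^bold>I\<^sup>+\<close> (applied to \<open>vp\<close>) and \<open>\<^bold>I\<^sup>-\<close> (applied to \<open>vm\<close>).\<close>

definition end_matrix :: "('e::finite \<Rightarrow> 'v::finite) \<Rightarrow> real ^ 'e ^ 'v" where
  "end_matrix w = (\<chi> v e. if w e = v then 1 else 0)"

definition incidence_matrix :: "('e::finite \<Rightarrow> 'v::finite) \<Rightarrow> ('e \<Rightarrow> 'v) \<Rightarrow> real ^ 'e ^ 'v" where
  "incidence_matrix vm vp = end_matrix vp - end_matrix vm"

definition flow_cost ::
    "('e::finite \<Rightarrow> real) \<Rightarrow> 'e location set \<Rightarrow> 'e location set \<Rightarrow> real ^ 'e \<Rightarrow> real" where
  "flow_cost len U V c = (\<Sum>e\<in>UNIV. profile_cost len e (c $ e) (imbalance U V e))"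

definition relaxed_flows ::
    "('e::finite \<Rightarrow> 'v::finite) \<Rightarrow> ('e \<Rightarrow> 'v) \<Rightarrow> ('e \<Rightarrow> real) \<Rightarrow>
      'e location set \<Rightarrow> 'e location set \<Rightarrow> (real ^ 'e) set" where
  "relaxed_flows vm vp len U V =
     {c. incidence_matrix vm vp *v c = end_matrix vp *v total_imbalance len U V}"

definition integer_flows ::
    "('e::finite \<Rightarrow> 'v::finite) \<Rightarrow> ('e \<Rightarrow> 'v) \<Rightarrow> ('e \<Rightarrow> real) \<Rightarrow>
      'e location set \<Rightarrow> 'e location set \<Rightarrow> (real ^ 'e) set" where
  "integer_flows vm vp len U V = {c \<in> relaxed_flows vm vp len U V. \<forall>e. c $ e \<in> \<int>}"

text \<open>
  Connectedness is not assumed, so the constraint may be unsolvable (a component may contain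
  unequally many supply and demand points). Optimal values are therefore infima in the extended
  reals, an infeasible problem having the value \<open>\<infinity>\<close>.
\<close>

definition Z_CF ::
    "('e::finite \<Rightarrow> 'v::finite) \<Rightarrow> ('e \<Rightarrow> 'v) \<Rightarrow> ('e \<Rightarrow> real) \<Rightarrow>
      'e location set \<Rightarrow> 'e location set \<Rightarrow> ereal" where
  "Z_CF vm vp len U V = (INF c\<in>integer_flows vm vp len U V. ereal (flow_cost len U V c))"

definition Z_RLX ::
    "('e::finite \<Rightarrow> 'v::finite) \<Rightarrow> ('e \<Rightarrow> 'v) \<Rightarrow> ('e \<Rightarrow> real) \<Rightarrow>
      'e location set \<Rightarrow> 'e location set \<Rightarrow> ereal" where
  "Z_RLX vm vp len U V = (INF c\<in>relaxed_flows vm vp len U V. ereal (flow_cost len U V c))"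

end

theory Submission
  imports Defs
begin

text \<open>
  Since the profiles are integer valued, the cost of an edge is affine in the flow between
  consecutive integers. If some coordinates of a flow are fractional, then every node incident to
  a fractional edge (loops aside) meets at least two of them, because its divergence is an integer.
  Hence there are at most as many such nodes as fractional edges; as the rows of the incidence
  matrix add up to zero, some nonzero circulation is supported on the fractional edges. Moving
  along it, in the direction in which the affine cost does not increase, until a coordinate becomes
  integral decreases the number of fractional coordinates.
\<close>

section \<open>Kernel vectors with prescribed support\<close>

text \<open>Dimension count: the vectors supported on \<open>F\<close> have dimension
  \<open>card F\<close>. Since the columns sum to zero, \<open>A\<close> maps them into the zero-sum
  vectors supported on the rows that \<open>F\<close> meets, a space of dimension smaller than
  \<open>card F\<close>, so \<open>A\<close> cannot be injective on them.\<close>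

lemma kernel_vector_supported_on:
  fixes A :: "'a::field ^ 'e ^ 'v"
  assumes colsum: "\<And>e. (\<Sum>v\<in>UNIV. A $ v $ e) = 0"
    and "F \<noteq> {}"
    and le: "card {v. \<exists>e\<in>F. A $ v $ e \<noteq> 0} \<le> card F"
  obtains d where "d \<noteq> 0" "\<And>e. e \<notin> F \<Longrightarrow> d $ e = 0" "A *v d = 0"
proof -
  define W where "W = {v. \<exists>e\<in>F. A $ v $ e \<noteq> 0}"
  define X where "X = {x :: 'a ^ 'e. \<forall>e. e \<notin> F \<longrightarrow> x $ e = 0}"
  define Y where "Y = {y :: 'a ^ 'v. \<forall>v. v \<notin> W \<longrightarrow> y $ v = 0}"
  define Y0 where "Y0 = {y \<in> Y. (\<Sum>v\<in>UNIV. y $ v) = 0}"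
  have subX: "vec.subspace X" and subY: "vec.subspace Y" and subY0: "vec.subspace Y0"
    by (auto simp: vec.subspace_def X_def Y_def Y0_def sum.distrib simp flip: sum_distrib_left)
  have dimX: "vec.dim X = card F" and dimY: "vec.dim Y = card W"
    unfolding X_def Y_def by (rule dim_substandard_cart)+
  have img: "(*v) A ` X \<subseteq> Y0"
  proof (safe, unfold Y0_def Y_def, safe)
    fix x v assume "x \<in> X" "v \<notin> W"
    then show "(A *v x) $ v = 0"
      unfolding matrix_vector_mult_def X_def W_def by (auto intro!: sum.neutral)
  next
    fix x
    have "(\<Sum>v\<in>UNIV. (A *v x) $ v) = (\<Sum>e\<in>UNIV. (\<Sum>v\<in>UNIV. A $ v $ e) * x $ e)"
      unfolding matrix_vector_mult_def by (simp add: sum_distrib_right) (rule sum.swap)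
    then show "(\<Sum>v\<in>UNIV. (A *v x) $ v) = 0" by (simp add: colsum)
  qed
  have "\<not> inj_on ((*v) A) X"
  proof
    assume inj: "inj_on ((*v) A) X"
    have "vec.span X = X" using subX by simp
    with inj have "vec.dim ((*v) A ` X) = vec.dim X"
      by (intro vec.dim_image_eq matrix_vector_mul_linear_gen) (simp only:)
    then have FY0: "card F \<le> vec.dim Y0"
      using vec.dim_subset[OF img] dimX by simp
    show False
    \<comment> \<open>With \<open>W\<close> empty the zero-sum condition does not lower the
      dimension, but the target is then the zero space and \<open>F\<close> is nonempty.\<close>
    proof (cases "W = {}")
      case True
      then have "Y0 \<subseteq> {0}" unfolding Y0_def Y_def by (auto simp: vec_eq_iff)
      then have "vec.dim Y0 = 0" by (simp add: vec.dim_eq_0)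
      moreover have "card F > 0" using \<open>F \<noteq> {}\<close> by (simp add: card_gt_0_iff)
      ultimately show False using FY0 by linarith
    next
      case False
      then obtain w where "w \<in> W" by auto
      \<comment> \<open>A unit vector has entry sum 1, so it witnesses that \<open>Y0\<close> is a
        proper subspace of \<open>Y\<close>.\<close>
      then have "axis w 1 \<in> Y" "axis w 1 \<notin> Y0" unfolding Y_def Y0_def by (auto simp: axis_def)
      moreover have "Y0 \<subseteq> Y" by (auto simp: Y0_def)
      ultimately have "vec.span Y0 \<subset> vec.span Y"
        unfolding vec.span_eq_iff[THEN iffD2, OF subY] vec.span_eq_iff[THEN iffD2, OF subY0] by auto
      then have "vec.dim Y0 < card W" using dimY vec.dim_psubset by metis
      then show False using FY0 le unfolding W_def by simp
    qed
  qed
  then obtain x y where xy: "x \<in> X" "y \<in> X" "x \<noteq> y" "A *v x = A *v y"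
    by (auto simp: inj_on_def)
  show thesis
  proof (rule that)
    show "x - y \<noteq> 0" using xy by simp
    show "\<And>e. e \<notin> F \<Longrightarrow> (x - y) $ e = 0" using xy by (simp add: X_def)
    show "A *v (x - y) = 0" using xy by (simp add: matrix_vector_mult_diff_distrib)
  qed
qed

section \<open>Affine pieces of the cost\<close>

lemma imbalance_Ints: "imbalance U V e x \<in> \<int>"
  by (simp add: imbalance_def)

text \<open>Each of the two counts is monotone in \<open>x\<close>, because the sets are finite, and
  hence integrable on a compact interval.\<close>

lemma imbalance_integrable:
  assumes "finite U" "finite V"
  shows "(\<lambda>x. \<bar>imbalance U V e x - c\<bar>) integrable_on {a..b}"
proof -
  have "integrable (lebesgue_on {a..b}) (\<lambda>x. real (card (S \<inter> edge_locations e x)))"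
    if "finite S" for S :: "'a location set"
    using that
    by (intro integrable_mono_on) (auto intro!: mono_onI card_mono simp: edge_locations_def)
  then have "integrable (lebesgue_on {a..b}) (\<lambda>x. \<bar>imbalance U V e x - c\<bar>)"
    unfolding imbalance_def using assms
    by (intro Bochner_Integration.integrable_abs Bochner_Integration.integrable_diff) auto
  then show ?thesis by (rule integrable_on_lebesgue_on) simp
qed

text \<open>The integer \<open>s\<close> is not strictly between \<open>k\<close> and
  \<open>k + 1\<close>, so the absolute value has no kink inside this interval and equals its linear
  interpolation.\<close>

lemma abs_diff_interpolate:
  fixes k s :: int and x :: real
  assumes "of_int k \<le> x" "x \<le> of_int k + 1"
  shows "\<bar>of_int s - x\<bar> =
    \<bar>of_int s - of_int k\<bar> + (x - of_int k) * (\<bar>of_int s - (of_int k + 1)\<bar> - \<bar>of_int s - of_int k\<bar>)"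
proof (cases "s \<le> k")
  case True
  then have "real_of_int s \<le> of_int k" by simp
  with assms show ?thesis by (simp add: abs_if algebra_simps)
next
  case False
  then have "real_of_int k + 1 \<le> of_int s"
    by linarith
  with assms show ?thesis by (simp add: abs_if algebra_simps)
qed

lemma profile_cost_affine:
  assumes "finite U" "finite V"
  obtains \<sigma> where "\<And>x. of_int k \<le> x \<Longrightarrow> x \<le> of_int k + 1 \<Longrightarrow>
    profile_cost len e x (imbalance U V e) =
    profile_cost len e (of_int k) (imbalance U V e) + (x - of_int k) * \<sigma>"
proof -
  let ?P = "\<lambda>x. profile_cost len e x (imbalance U V e)"
  have "?P x = ?P (of_int k) + (x - of_int k) * (?P (of_int k + 1) - ?P (of_int k))"
    if x: "of_int k \<le> x" "x \<le> of_int k + 1" for x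
  proof -
    let ?S = "imbalance U V e"
    have pw: "\<bar>?S t - x\<bar> = \<bar>?S t - of_int k\<bar> +
        (x - of_int k) * (\<bar>?S t - (of_int k + 1)\<bar> - \<bar>?S t - of_int k\<bar>)" for t
      using abs_diff_interpolate[OF x] imbalance_Ints[of U V e t] by (metis Ints_cases)
    note int = imbalance_integrable[OF assms]
    have "((\<lambda>t. \<bar>?S t - x\<bar>) has_integral
        ?P (of_int k) + (x - of_int k) * (?P (of_int k + 1) - ?P (of_int k))) {0..len e}"
      unfolding pw profile_cost_def
      by (intro has_integral_add has_integral_mult_right has_integral_diff integrable_integral int)
    then show ?thesis
      unfolding profile_cost_def by (rule integral_unique)
  qed
  then show thesis by (rule that)
qed

text \<open>The slope of each edge is that of the interval starting at the floor of
  \<open>c $ e\<close>. At an integral coordinate the box shrinks to a point, so a kink of the cost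
  there does no harm.\<close>

lemma flow_cost_affine:
  fixes c :: "real ^ 'e::finite"
  assumes "finite U" "finite V"
  obtains \<sigma> where "\<And>c'. (\<And>e. of_int \<lfloor>c $ e\<rfloor> \<le> c' $ e \<and> c' $ e \<le> of_int \<lceil>c $ e\<rceil>) \<Longrightarrow>
    flow_cost len U V c' = flow_cost len U V c + (\<Sum>e\<in>UNIV. (c' $ e - c $ e) * \<sigma> e)"
proof -
  have "\<exists>s. \<forall>x. of_int \<lfloor>c $ e\<rfloor> \<le> x \<and> x \<le> of_int \<lfloor>c $ e\<rfloor> + 1 \<longrightarrow>
    profile_cost len e x (imbalance U V e) =
    profile_cost len e (of_int \<lfloor>c $ e\<rfloor>) (imbalance U V e) + (x - of_int \<lfloor>c $ e\<rfloor>) * s" for e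
    by (rule profile_cost_affine[OF assms]) blast
  then obtain \<sigma> where \<sigma>: "\<And>e x. of_int \<lfloor>c $ e\<rfloor> \<le> x \<Longrightarrow> x \<le> of_int \<lfloor>c $ e\<rfloor> + 1 \<Longrightarrow>
    profile_cost len e x (imbalance U V e) =
    profile_cost len e (of_int \<lfloor>c $ e\<rfloor>) (imbalance U V e) + (x - of_int \<lfloor>c $ e\<rfloor>) * \<sigma> e"
    by metis
  have "flow_cost len U V c' = flow_cost len U V c + (\<Sum>e\<in>UNIV. (c' $ e - c $ e) * \<sigma> e)"
    if c': "\<And>e. of_int \<lfloor>c $ e\<rfloor> \<le> c' $ e \<and> c' $ e \<le> of_int \<lceil>c $ e\<rceil>" for c' :: "real ^ 'e"
  proof -
    have "profile_cost len e (c' $ e) (imbalance U V e) =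
        profile_cost len e (c $ e) (imbalance U V e) + (c' $ e - c $ e) * \<sigma> e" for e
    proof -
      have "real_of_int \<lceil>c $ e\<rceil> \<le> of_int \<lfloor>c $ e\<rfloor> + 1"
        by (simp add: ceiling_altdef)
      then have "c' $ e \<le> of_int \<lfloor>c $ e\<rfloor> + 1" using c'[of e] by linarith
      moreover have "c $ e \<le> of_int \<lfloor>c $ e\<rfloor> + 1" by linarith
      ultimately show ?thesis
        using \<sigma>[of e "c' $ e"] \<sigma>[of e "c $ e"] c'[of e] by (simp add: algebra_simps)
    qed
    then show ?thesis unfolding flow_cost_def by (simp add: sum.distrib)
  qed
  then show thesis by (rule that)
qed

section \<open>Moving to an integral coordinate\<close>

text \<open>A ratio test: \<open>t\<close> is the first time at which a moving coordinate reaches an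
  end of its box. That coordinate becomes integral, and those already integral do not move.\<close>

lemma move_until_integral:
  fixes c d :: "real ^ 'e::finite"
  assumes "d \<noteq> 0" and supp: "\<And>e. c $ e \<in> \<int> \<Longrightarrow> d $ e = 0"
  obtains t where "t \<ge> 0"
    "\<And>e. of_int \<lfloor>c $ e\<rfloor> \<le> (c + t *\<^sub>R d) $ e \<and> (c + t *\<^sub>R d) $ e \<le> of_int \<lceil>c $ e\<rceil>"
    "{e. (c + t *\<^sub>R d) $ e \<notin> \<int>} \<subset> {e. c $ e \<notin> \<int>}"
proof -
  \<comment> \<open>The signed distance from \<open>c $ e\<close> to the integer towards which
    \<open>d\<close> moves it.\<close>
  define g where "g e = (if d $ e > 0 then of_int \<lceil>c $ e\<rceil> else of_int \<lfloor>c $ e\<rfloor>) - c $ e" for e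
  define E where "E = {e. d $ e \<noteq> 0}"
  have "E \<noteq> {}" using \<open>d \<noteq> 0\<close> by (auto simp: E_def vec_eq_iff)
  define t where "t = Min ((\<lambda>e. g e / d $ e) ` E)"
  have "t \<in> (\<lambda>e. g e / d $ e) ` E" unfolding t_def using \<open>E \<noteq> {}\<close> by (intro Min_in) auto
  then obtain e0 where e0: "e0 \<in> E" "t = g e0 / d $ e0" by auto
  have tle: "t \<le> g e / d $ e" if "e \<in> E" for e unfolding t_def using that by simp
  \<comment> \<open>Numerator and denominator never have opposite signs; for
    \<open>d $ e = 0\<close> the quotient is 0 by convention.\<close>
  have "g e / d $ e \<ge> 0" for e
    unfolding g_def by (auto simp: zero_le_divide_iff)
  then have "t \<ge> 0" using e0 by simp
  have box: "of_int \<lfloor>c $ e\<rfloor> \<le> c $ e + t * d $ e \<and> c $ e + t * d $ e \<le> of_int \<lceil>c $ e\<rceil>" for e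
  proof -
    consider "d $ e = 0" | "d $ e > 0" | "d $ e < 0" by linarith
    then show ?thesis
    proof cases
      case 1
      then show ?thesis by simp
    next
      case 2
      then have "t * d $ e \<le> of_int \<lceil>c $ e\<rceil> - c $ e" "0 \<le> t * d $ e"
        using tle[of e] \<open>t \<ge> 0\<close> by (auto simp: E_def g_def field_simps)
      then show ?thesis by linarith
    next
      case 3
      then have "t * d $ e \<ge> of_int \<lfloor>c $ e\<rfloor> - c $ e" "t * d $ e \<le> 0"
        using tle[of e] \<open>t \<ge> 0\<close> by (auto simp: E_def g_def field_simps mult_nonneg_nonpos)
      then show ?thesis by linarith
    qed
  qed
  have "c $ e0 + t * d $ e0 \<in> \<int>" using e0 by (auto simp: E_def g_def)
  moreover have "c $ e0 \<notin> \<int>" using supp e0 by (auto simp: E_def)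
  moreover have "{e. c $ e + t * d $ e \<notin> \<int>} \<subseteq> {e. c $ e \<notin> \<int>}" using supp by auto
  ultimately show thesis using that[of t] \<open>t \<ge> 0\<close> box by auto
qed

section \<open>Counting nodes at fractional edges\<close>

lemma incidence_matrix_nth:
  "incidence_matrix vm vp $ v $ e = of_bool (vp e = v) - of_bool (vm e = v)"
  by (simp add: incidence_matrix_def end_matrix_def)

text \<open>Double counting of the pairs of a fractional edge and a node with nonzero incidence
  entry: a node counted here lies in at least two pairs, an edge in at most two.\<close>

lemma card_fractional_nodes_le:
  fixes vm vp :: "'e::finite \<Rightarrow> 'v::finite" and c :: "real ^ 'e"
  assumes int: "\<And>v. (incidence_matrix vm vp *v c) $ v \<in> \<int>"
  defines "F \<equiv> {e. c $ e \<notin> \<int>}"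
  shows "card {v. \<exists>e\<in>F. incidence_matrix vm vp $ v $ e \<noteq> 0} \<le> card F"
proof -
  define A where "A = incidence_matrix vm vp"
  define W where "W = {v. \<exists>e\<in>F. A $ v $ e \<noteq> 0}"
  \<comment> \<open>Loops drop out of \<open>N v\<close>, as their two contributions to the entry
    cancel.\<close>
  define N where "N v = {e \<in> F. A $ v $ e \<noteq> 0}" for v
  have two: "2 \<le> card (N v)" if "v \<in> W" for v
  proof (rule ccontr)
    assume "\<not> 2 \<le> card (N v)"
    moreover have "N v \<noteq> {}" using that by (auto simp: W_def N_def)
    ultimately have "card (N v) = 1"
      using card_gt_0_iff[of "N v"] by simp
    then obtain e where e: "N v = {e}" by (auto simp: card_1_singleton_iff)
    have AZ: "A $ v $ e' \<in> \<int>" for e' by (simp add: A_def incidence_matrix_nth)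
    have "(A *v c) $ v = A $ v $ e * c $ e + (\<Sum>e'\<in>UNIV - {e}. A $ v $ e' * c $ e')"
      unfolding matrix_vector_mult_def by (simp add: sum.remove[of UNIV e])
    moreover have "(\<Sum>e'\<in>UNIV - {e}. A $ v $ e' * c $ e') \<in> \<int>"
    proof (rule Ints_sum)
      fix e' assume "e' \<in> UNIV - {e}"
      then have "e' \<notin> N v" using e by auto
      then show "A $ v $ e' * c $ e' \<in> \<int>" using AZ by (auto simp: N_def F_def)
    qed
    ultimately have "A $ v $ e * c $ e \<in> \<int>"
      using int[of v] by (metis A_def Ints_diff add_diff_cancel_right')
    moreover have "A $ v $ e \<noteq> 0" "c $ e \<notin> \<int>" using e by (auto simp: N_def F_def)
    \<comment> \<open>The nonzero entry is 1 or -1, so the lone fractional value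
      \<open>c $ e\<close> would be an integer.\<close>
    ultimately show False
      by (auto simp: A_def incidence_matrix_nth of_bool_def split: if_splits)
  qed
  have "card {v \<in> W. A $ v $ e \<noteq> 0} \<le> 2" for e
  proof -
    have "{v \<in> W. A $ v $ e \<noteq> 0} \<subseteq> {vp e, vm e}"
      by (auto simp: A_def incidence_matrix_nth of_bool_def split: if_splits)
    then have "card {v \<in> W. A $ v $ e \<noteq> 0} \<le> card {vp e, vm e}" by (rule card_mono[rotated]) simp
    also have "\<dots> \<le> 2" by (simp add: card_insert_if)
    finally show ?thesis .
  qed
  then have "(\<Sum>e\<in>F. card {v \<in> W. A $ v $ e \<noteq> 0}) \<le> 2 * card F"
    using sum_bounded_above[of F "\<lambda>e. card {v \<in> W. A $ v $ e \<noteq> 0}" 2] by simp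
  moreover have "(\<Sum>e\<in>F. card {v \<in> W. A $ v $ e \<noteq> 0}) = (\<Sum>v\<in>W. card (N v))"
    unfolding N_def by (rule sum_multicount_gen[symmetric]) auto
  moreover have "2 * card W \<le> (\<Sum>v\<in>W. card (N v))"
    using sum_bounded_below[of W 2 "\<lambda>v. card (N v)"] two by simp
  ultimately show ?thesis by (simp add: W_def A_def)
qed

section \<open>Descent to an integer flow\<close>

text \<open>The right-hand side of the flow constraint adds up integer edge imbalances, so the
  divergence is integral even where \<open>c\<close> is fractional.\<close>

lemma relaxed_flow_divergence_Ints:
  assumes "c \<in> relaxed_flows vm vp len U V"
  shows "(incidence_matrix vm vp *v c) $ v \<in> \<int>"
proof -
  have "(incidence_matrix vm vp *v c) $ v = (end_matrix vp *v total_imbalance len U V) $ v"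
    using assms by (simp add: relaxed_flows_def)
  also have "\<dots> \<in> \<int>"
    unfolding matrix_vector_mult_def
    by (auto simp: end_matrix_def total_imbalance_def imbalance_Ints intro!: Ints_sum)
  finally show ?thesis .
qed

lemma relaxed_flow_reduce_fractional:
  fixes vm vp :: "'e::finite \<Rightarrow> 'v::finite"
  assumes fin: "finite U" "finite V"
    and c: "c \<in> relaxed_flows vm vp len U V" and frac: "{e. c $ e \<notin> \<int>} \<noteq> {}"
  obtains c' where "c' \<in> relaxed_flows vm vp len U V"
    "flow_cost len U V c' \<le> flow_cost len U V c"
    "{e. c' $ e \<notin> \<int>} \<subset> {e. c $ e \<notin> \<int>}"
proof -
  let ?A = "incidence_matrix vm vp"
  have "(\<Sum>v\<in>UNIV. ?A $ v $ e) = 0" for e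
    by (simp add: incidence_matrix_nth sum_subtractf of_bool_def)
  then obtain d0 where d0: "d0 \<noteq> 0" "\<And>e. c $ e \<in> \<int> \<Longrightarrow> d0 $ e = 0" "?A *v d0 = 0"
    using kernel_vector_supported_on[of ?A "{e. c $ e \<notin> \<int>}"] frac
      card_fractional_nodes_le[OF relaxed_flow_divergence_Ints[OF c]] by auto
  obtain \<sigma> where \<sigma>: "\<And>c'. (\<And>e. of_int \<lfloor>c $ e\<rfloor> \<le> c' $ e \<and> c' $ e \<le> of_int \<lceil>c $ e\<rceil>) \<Longrightarrow>
    flow_cost len U V c' = flow_cost len U V c + (\<Sum>e\<in>UNIV. (c' $ e - c $ e) * \<sigma> e)"
    by (rule flow_cost_affine[OF fin, where c = c and len = len]) blast
  \<comment> \<open>Both \<open>d0\<close> and \<open>- d0\<close> are circulations, and the affine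
    cost does not increase along at least one of them.\<close>
  define d where "d = (if (\<Sum>e\<in>UNIV. d0 $ e * \<sigma> e) \<le> 0 then d0 else - d0)"
  have slope: "(\<Sum>e\<in>UNIV. d $ e * \<sigma> e) \<le> 0"
    by (auto simp: d_def sum_negf)
  have d: "d \<noteq> 0" "\<And>e. c $ e \<in> \<int> \<Longrightarrow> d $ e = 0"
    using d0 by (auto simp: d_def)
  have "?A *v d = 0"
    using d0(3) matrix_vector_mult_diff_distrib[of ?A 0 d0] by (auto simp: d_def)
  obtain t where t: "t \<ge> 0"
    "\<And>e. of_int \<lfloor>c $ e\<rfloor> \<le> (c + t *\<^sub>R d) $ e \<and> (c + t *\<^sub>R d) $ e \<le> of_int \<lceil>c $ e\<rceil>"
    "{e. (c + t *\<^sub>R d) $ e \<notin> \<int>} \<subset> {e. c $ e \<notin> \<int>}"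
    using move_until_integral[OF d] by blast
  show thesis
  proof (rule that)
    show "c + t *\<^sub>R d \<in> relaxed_flows vm vp len U V"
      using c \<open>?A *v d = 0\<close>
      by (simp add: relaxed_flows_def matrix_vector_right_distrib matrix_vector_mult_scaleR)
    have "(\<Sum>e\<in>UNIV. ((c + t *\<^sub>R d) $ e - c $ e) * \<sigma> e) = t * (\<Sum>e\<in>UNIV. d $ e * \<sigma> e)"
      by (simp add: sum_distrib_left mult.assoc)
    also have "\<dots> \<le> 0" using t(1) slope by (rule mult_nonneg_nonpos)
    finally show "flow_cost len U V (c + t *\<^sub>R d) \<le> flow_cost len U V c"
      using \<sigma>[OF t(2)] by simp
  qed (fact t(3))
qed

text \<open>Induction on the number of fractional coordinates. Dominating each relaxed flow
  separately compares the infima without appeal to minimizers and covers the infeasible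
  case.\<close>

lemma integer_flow_no_costlier:
  fixes vm vp :: "'e::finite \<Rightarrow> 'v::finite"
  assumes "finite U" "finite V" "c \<in> relaxed_flows vm vp len U V"
  shows "\<exists>c'\<in>integer_flows vm vp len U V. flow_cost len U V c' \<le> flow_cost len U V c"
  using assms(3)
proof (induction "card {e. c $ e \<notin> \<int>}" arbitrary: c rule: less_induct)
  case less
  show ?case
  proof (cases "{e. c $ e \<notin> \<int>} = {}")
    case True
    then show ?thesis using less.prems by (auto simp: integer_flows_def)
  next
    case False
    then obtain c' where c': "c' \<in> relaxed_flows vm vp len U V"
      "flow_cost len U V c' \<le> flow_cost len U V c" "{e. c' $ e \<notin> \<int>} \<subset> {e. c $ e \<notin> \<int>}"
      using relaxed_flow_reduce_fractional[OF assms(1,2) less.prems] by blast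
    then show ?thesis
      using less.hyps[OF psubset_card_mono[OF finite c'(3)] c'(1)] by (meson order_trans)
  qed
qed

theorem theorem2:
  fixes vm vp :: "'e::finite \<Rightarrow> 'v::finite"
    and len :: "'e \<Rightarrow> real"
    and U V :: "'e location set"
    and n :: nat
  assumes "\<And>e. len e \<ge> 0"
    and "finite U" and "finite V"
    and "U \<subseteq> locations len" and "V \<subseteq> locations len"
    and "card U = n" and "card V = n"
  shows "Z_CF vm vp len U V = Z_RLX vm vp len U V"
  unfolding Z_CF_def Z_RLX_def
proof (rule antisym)
  show "(INF c\<in>integer_flows vm vp len U V. ereal (flow_cost len U V c))
      \<le> (INF c\<in>relaxed_flows vm vp len U V. ereal (flow_cost len U V c))"
    using integer_flow_no_costlier[OF \<open>finite U\<close> \<open>finite V\<close>] by (intro INF_mono) simp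
  show "(INF c\<in>relaxed_flows vm vp len U V. ereal (flow_cost len U V c))
      \<le> (INF c\<in>integer_flows vm vp len U V. ereal (flow_cost len U V c))"
    by (rule INF_superset_mono) (auto simp: integer_flows_def)
qed

end
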